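(* Let $I\subset\mathbb{R}$ be a compact interval, let $\Delta\subset I$ be a finite union of open intervals with pairwise disjoint closures, and let $\omega\subset\mathbb{R}$ be a compact interval. For each $a\in\omega$, let $f_a\colon I\setminus\Delta\to I$ be a $C^1$ map with non-vanishing derivative. Assume that $F$, $DF$, $F^{-1}$ are numerical methods that assign to each compact interval $J\subset I\setminus\Delta$ compact intervals satisfying $$F(J)\supset\{f_a(x):a\in\omega,\ x\in J\},\qquad DF(J)\supset\{Df_a(x):a\in\omega,\ x\in J\},$$ $$F^{-1}(J)\supset\{x\in I\setminus\Delta: f_a(x)\in J\text{ for some }a\in\omega\}.$$ Let $K\in\mathbb{N}$. Then the quantity computed by the algorithm ExpansionExponent (described in the context) applied to $I,\Delta,\omega,F,DF,F^{-1}$ and $K$ is either $+\infty$ or a number $\lambda\in\mathbb{R}$ that is a lower bound on the expansion exponent of $f_a$ on $I\setminus\Delta$ for every $a\in\omega$; that is, for every $a\in\omega$ there is $C>0$ such that $$|(f_a^n)'(x)|\ge Ce^{\lambda n}$$ for all $n\ge1$ and all $x\in I$ with $f_a^i(x)\notin\Delta$ for $i=0,\dots,n-1$. Moreover, each number $\lambda_{\max}$ (if any) obtained during the computations, as the value returned by a call of the algorithm PeriodicOrbit (described in the context) for the map $f_a$, is an upper bound on the expansion exponent of $f_a$ on $I\setminus\Delta$; that is, if $\lambda'\in\mathbb{R}$ and $C>0$ are such that $|(f_a^n)'(x)|\ge Ce^{\lambda' n}$ for all $n\ge1$ and all $x\in I$ with $f_a^i(x)\notin\Delta$ for $i=0,\dots,n-1$,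 then $\lambda'\le\lambda_{\max}$.
   Context: Derivatives are with respect to the space variable $x$; $Df_a=f_a'$. Weighted digraphs. A weighted digraph is $G=(V,E,w)$ with $V$ finite, $E\subset V\times V$ (loops allowed), $w\colon E\to\mathbb{R}$. A path is a nonempty finite sequence of consecutive edges $\gamma=(e_1,\dots,e_n)$ of length $|\gamma|=n$ and mean weight $\overline{w}(\gamma)=\frac1n\sum_j w(e_j)$; it is a cycle if its starting and ending vertices coincide. The minimum cycle mean is $\mu(G)=\min\{\overline{w}(\gamma):\gamma\text{ a cycle in }G\}$, and $\mu(G)=+\infty$ if $G$ has no cycle. Algorithm MinimumCycleMean for a strongly connected digraph $G=(V,E,w)$ with at least one edge: choose $s\in V$, put $n=|V|$, $F_0(s)=0$, $F_0(v)=\infty$ for $v\neq s$; for $k=1,\dots,n$ and $v\in V$ compute $F_k(v)=\min\{F_{k-1}(u)+w(u,v):(u,v)\in E\}$ ($\infty$ if there is no such edge), recording a minimising predecessor $P_k(v)=u$ when the value is finite. For $v$ with $F_n(v)<\infty$ put $M(v)=\max_{0\le k\le n-1}(F_n(v)-F_k(v))/(n-k)$ and let $v_n$ minimise $M$. Return $\lambda=M(v_n)$ and any cycle $\gamma$ contained (as a contiguous subsequence of edges) in the path $v_0\to v_1\to\dots\to v_n$, where $v_{k-1}=P_k(v_k)$. For a general digraph, the algorithm is applied to all strongly connected components containing at least one edge, and the smallest $\lambda$ with a corresponding $\gamma$ is returned; the result is $\lambda=+\infty$ (and no cycle) if $G$ has no cycle. These computations are regarded as exact. Admissible partition: a finite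 collection $\mathcal{I}$ of compact intervals contained in $I\setminus\Delta$, with pairwise disjoint interiors, whose union contains $I\setminus\Delta$. Graph construction for an admissible partition $\mathcal{I}=\{I_1,\dots,I_k\}$: $V=\mathcal{I}$; $E=\{(I_i,I_j): F(I_i)\cap I_j\ne\emptyset\}$; for each edge $e=(I_i,I_j)$ determine a nonempty closed interval $L(e)\subset I_i$ containing $\{x\in I_i: f_a(x)\in I_j\text{ for some }a\in\omega\}$ (for instance $I_i$ itself, or $I_i\cap F^{-1}(I_j)$ if nonempty) and, by computing $\ln|DF(L(e))|$ in interval arithmetic, a real number $b(L(e))\le\min\{\ln|Df_a(x)|:x\in L(e),\ a\in\omega\}$; set $w(e)=b(L(e))$. Algorithm ExpansionExponent (input $I,\Delta,\omega,F,DF,F^{-1},K$): put $k_0=\max\{9,\text{number of intervals forming } I\setminus\Delta\}$; take an admissible partition $\mathcal{I}^0$ of $I\setminus\Delta$ into $k_0$ intervals of approximately the same size; let $\mathcal{I}$ be the admissible partition returned by Refine applied to $\mathcal{I}^0$ and $K$; build the graph $G$ from $\mathcal{I}$ by the graph construction; return the number $\lambda$ given by MinimumCycleMean for $G$. Algorithm Refine (input $\mathcal{I}^0$, $K$; fixed parameters $\xi>0$, $n_0>0$, $\eta\ge1$): set $\mathcal{I}:=\mathcal{I}^0$. While $\operatorname{card}\mathcal{I}\le K$: build the graph $G$ from $\mathcal{I}$; apply MinimumCycleMean to get $\lambda$ and a cycle $\gamma$; if all intervals in $\gamma$ have width below $\xi|I|$, apply PeriodicOrbit (for a candidate interval and period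 provided by $\gamma$) in an attempt to obtain a number $\lambda_{\max}$; for each vertex $[p_l,p_r]$ of $\gamma$ let $p$ be a computer-representable number closest to $(p_l+p_r)/2$, and if $p_l<p<p_r$ replace $[p_l,p_r]$ in $\mathcal{I}$ by $[p_l,p]$ and $[p,p_r]$, returning $\mathcal{I}$ if now $\operatorname{card}\mathcal{I}=K$; if no interval was split, or if the loop has run more than $n_0$ times and $\lambda\le\eta\lambda'$ where $\lambda'$ is the value of $\lambda$ from $n_0$ runs earlier, return $\mathcal{I}$. After the loop return $\mathcal{I}$. Algorithm PeriodicOrbit (input: a map $f=f_a$, the set $\Delta$, an interval $[x_1,x_2]\subset I\setminus\Delta$, an integer $n>0$): put $x_0=(x_1+x_2)/2$. Using interval arithmetic, compute intervals $F^n_{x_0}\ni f^n(x_0)$; $G_{x_0}\ni g(x_0)$, where $g(x)=x-f^n(x)$; $(F^n_x)'$ containing $(f^n)'(x)$ for all $x\in[x_1,x_2]$; and $G'_x$ containing $g'(x)=1-(f^n)'(x)$ for all $x\in[x_1,x_2]$. Return $\emptyset$ (failure) if $0\in G'_x$. Compute an interval $N_x$ containing $x_0-g(x_0)/g'(x)$ for all $x\in[x_1,x_2]$ (namely an enclosure of $x_0-G_{x_0}/G_x'$); return $\emptyset$ if $N_x$ is not contained in the interior of $[x_1,x_2]$. Return $\emptyset$ if $0\in(F^n_x)'$. Compute intervals $F^i_x$ containing $f^i([x_1,x_2])$ for $i=1,\dots,n$; return $\emptyset$ if $F^i_x\cap\Delta\ne\emptyset$ for some $i\in\{1,\dots,n\}$.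 Otherwise return a number $\lambda_{\max}$ that is an upper bound on $\ln(|(f^n)'(x)|)/n$ for all $x\in[x_1,x_2]$. All enclosures are rigorous; if one cannot be computed, the result is $\emptyset$. *)

theory Defs
  imports
    "Graph_Theory.Pair_Digraph"
    "Graph_Theory.Digraph_Component"
    "HOL-Library.Sublist"
    "HOL-Library.Interval"
    "HOL-Analysis.Analysis"
begin

section \<open>Derivatives of iterates\<close>

text \<open>
  The map is a total function of which only the values on \<open>I - \<Delta>\<close> matter; its \<open>n\<close>-th iterate
  is defined on the set \<open>iter_dom\<close>. The derivative of the iterate is the product given by the
  chain rule, because \<open>iter_dom\<close> can have isolated points (an endpoint of a component of
  \<open>I - \<Delta>\<close> may be mapped to an endpoint of another component while all nearby points fall
  into \<open>\<Delta>\<close>). The two lemmas below show that at all other points the product is the derivative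
  of the iterate.
\<close>

definition iter_dom :: "real set \<Rightarrow> real set \<Rightarrow> (real \<Rightarrow> real) \<Rightarrow> nat \<Rightarrow> real set" where
  "iter_dom I \<Delta> f n = {x \<in> I. \<forall>i<n. (f ^^ i) x \<notin> \<Delta>}"

definition iter_deriv :: "(real \<Rightarrow> real) \<Rightarrow> (real \<Rightarrow> real) \<Rightarrow> nat \<Rightarrow> real \<Rightarrow> real" where
  "iter_deriv f Df n x = (\<Prod>i<n. Df ((f ^^ i) x))"

lemma iter_dom_orbit:
  assumes "f ` (I - \<Delta>) \<subseteq> I" "x \<in> iter_dom I \<Delta> f n"
  shows "i \<le> n \<Longrightarrow> (f ^^ i) x \<in> I"
proof (induction i)
  case 0
  then show ?case using assms(2) by (simp add: iter_dom_def)
next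
  case (Suc i)
  then have "(f ^^ i) x \<in> I - \<Delta>" using assms(2) by (simp add: iter_dom_def)
  then show ?case using assms(1) by auto
qed

lemma has_real_derivative_iter_deriv:
  assumes "f ` (I - \<Delta>) \<subseteq> I"
    and der: "\<And>y. y \<in> I - \<Delta> \<Longrightarrow> (f has_real_derivative Df y) (at y within I - \<Delta>)"
    and "x \<in> iter_dom I \<Delta> f n"
  shows "((f ^^ n) has_real_derivative iter_deriv f Df n x) (at x within iter_dom I \<Delta> f n)"
  using assms(3)
proof (induction n)
  case 0
  show ?case by (simp add: iter_deriv_def id_def)
next
  case (Suc n)
  let ?S = "iter_dom I \<Delta> f n" and ?T = "iter_dom I \<Delta> f (Suc n)"
  have sub: "?T \<subseteq> ?S" by (auto simp: iter_dom_def)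
  have img: "(f ^^ n) ` ?T \<subseteq> I - \<Delta>"
    using iter_dom_orbit[OF assms(1)] by (fastforce simp: iter_dom_def)
  have "((f ^^ n) has_real_derivative iter_deriv f Df n x) (at x within ?T)"
    using Suc.IH Suc.prems sub by (blast intro: DERIV_subset)
  moreover have "(f has_real_derivative Df ((f ^^ n) x)) (at ((f ^^ n) x) within (f ^^ n) ` ?T)"
    using der img Suc.prems by (blast intro: DERIV_subset)
  ultimately have "(f \<circ> (f ^^ n) has_real_derivative Df ((f ^^ n) x) * iter_deriv f Df n x)
      (at x within ?T)"
    by (intro DERIV_image_chain)
  then show ?case by (simp add: iter_deriv_def mult.commute o_def)
qed

lemma iter_deriv_unique:
  assumes "f ` (I - \<Delta>) \<subseteq> I"
    and "\<And>y. y \<in> I - \<Delta> \<Longrightarrow> (f has_real_derivative Df y) (at y within I - \<Delta>)"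
    and "x \<in> iter_dom I \<Delta> f n" "x islimpt iter_dom I \<Delta> f n"
  shows "((f ^^ n) has_real_derivative D) (at x within iter_dom I \<Delta> f n)
    \<longleftrightarrow> D = iter_deriv f Df n x"
proof -
  have "at x within iter_dom I \<Delta> f n \<noteq> bot"
    using assms(4) by (simp add: trivial_limit_within)
  then show ?thesis
    using has_real_derivative_iter_deriv[OF assms(1-3)] has_field_derivative_unique by blast
qed


section \<open>Minimum cycle mean\<close>

text \<open>
  A weighted digraph is given by a \<^typ>\<open>('v, 'v \<times> 'v) pre_digraph\<close>, with \<^const>\<open>fst\<close> and
  \<^const>\<open>snd\<close> as tail and head, and by a weight function that matters on the arcs only.
  Cycles are nonempty closed walks, which may repeat vertices (unlike
  \<open>pre_digraph.cycle\<close>).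
\<close>

type_synonym 'v digraph = "('v, 'v \<times> 'v) pre_digraph"

definition closed_path :: "'v digraph \<Rightarrow> ('v \<times> 'v) list \<Rightarrow> bool" where
  "closed_path G \<gamma> \<longleftrightarrow> \<gamma> \<noteq> [] \<and> (\<exists>u. pre_digraph.awalk G u \<gamma> u)"

text \<open>The infimum is a minimum for finite \<open>G\<close>, and it is \<open>\<infinity>\<close> if there is no arc into \<open>v\<close>.\<close>

primrec karp_F :: "'v digraph \<Rightarrow> ('v \<times> 'v \<Rightarrow> real) \<Rightarrow> 'v \<Rightarrow> nat \<Rightarrow> 'v \<Rightarrow> ereal" where
  "karp_F G w s 0 v = (if v = s then 0 else \<infinity>)"
| "karp_F G w s (Suc k) v = (INF u\<in>{u. (u, v) \<in> arcs G}. karp_F G w s k u + ereal (w (u, v)))"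

definition karp_M :: "'v digraph \<Rightarrow> ('v \<times> 'v \<Rightarrow> real) \<Rightarrow> 'v \<Rightarrow> 'v \<Rightarrow> ereal" where
  "karp_M G w s v = (let n = card (verts G) in
     (MAX k\<in>{0..n-1}. (karp_F G w s n v - karp_F G w s k v) / ereal (real (n - k))))"

text \<open>
  The algorithms leave some choices open (here: the start vertex \<open>s\<close>, the minimising
  predecessors \<open>P\<close>, the minimiser \<open>p n\<close> of \<open>M\<close> and the cycle). They are therefore rendered as
  relations that hold of every possible result.
\<close>

definition min_cycle_mean_sc ::
  "'v digraph \<Rightarrow> ('v \<times> 'v \<Rightarrow> real) \<Rightarrow> ereal \<Rightarrow> ('v \<times> 'v) list \<Rightarrow> bool" where
  "min_cycle_mean_sc G w l \<gamma> \<longleftrightarrow>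
    (\<exists>s\<in>verts G. \<exists>(P :: nat \<Rightarrow> 'v \<Rightarrow> 'v) (p :: nat \<Rightarrow> 'v). let n = card (verts G) in
      (\<forall>k\<in>{1..n}. \<forall>v\<in>verts G. karp_F G w s k v < \<infinity> \<longrightarrow>
         (P k v, v) \<in> arcs G \<and>
         karp_F G w s k v = karp_F G w s (k - 1) (P k v) + ereal (w (P k v, v))) \<and>
      is_arg_min (karp_M G w s) (\<lambda>v. v \<in> verts G \<and> karp_F G w s n v < \<infinity>) (p n) \<and>
      l = karp_M G w s (p n) \<and>
      (\<forall>k\<in>{1..n}. p (k - 1) = P k (p k)) \<and>
      closed_path G \<gamma> \<and> sublist \<gamma> (map (\<lambda>k. (p k, p (Suc k))) [0..<n]))"

definition min_cycle_mean ::
  "'v digraph \<Rightarrow> ('v \<times> 'v \<Rightarrow> real) \<Rightarrow> ereal \<Rightarrow> ('v \<times> 'v) list option \<Rightarrow> bool" where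
  "min_cycle_mean G w l \<gamma> \<longleftrightarrow>
    (let \<C> = {H \<in> pre_digraph.sccs G. arcs H \<noteq> {}} in
     if \<C> = {} then l = \<infinity> \<and> \<gamma> = None
     else \<exists>lH \<gamma>H. (\<forall>H\<in>\<C>. min_cycle_mean_sc H w (lH H) (\<gamma>H H)) \<and>
       (\<exists>H. is_arg_min lH (\<lambda>H. H \<in> \<C>) H \<and> l = lH H \<and> \<gamma> = Some (\<gamma>H H)))"


section \<open>Partitions and the associated weighted digraph\<close>

definition admissible_partition ::
  "real interval \<Rightarrow> real set \<Rightarrow> real interval set \<Rightarrow> bool" where
  "admissible_partition I \<Delta> \<I> \<longleftrightarrow>
    finite \<I> \<and> (\<forall>J\<in>\<I>. set_of J \<subseteq> set_of I - \<Delta>) \<and>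
    pairwise (\<lambda>J J'. interior (set_of J) \<inter> interior (set_of J') = {}) \<I> \<and>
    set_of I - \<Delta> \<subseteq> (\<Union>J\<in>\<I>. set_of J)"

definition partition_graph ::
  "(real interval \<Rightarrow> real interval) \<Rightarrow> real interval set \<Rightarrow> real interval digraph" where
  "partition_graph F \<I> = with_proj
     \<lparr>pverts = \<I>, parcs = {(J, J'). J \<in> \<I> \<and> J' \<in> \<I> \<and> set_of (F J) \<inter> set_of J' \<noteq> {}}\<rparr>"

text \<open>
  \<open>L e\<close> is any interval with the required property, so the choice \<open>J \<inter> F\<inverse>(J')\<close> is included.
  \<open>b\<close> is a real lower bound obtained from \<open>ln \<bar>DF (L e)\<bar>\<close>, which exists only if \<open>0 \<notin> DF (L e)\<close>.
\<close>

definition partition_weight ::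
  "real interval \<Rightarrow> (real \<Rightarrow> real \<Rightarrow> real) \<Rightarrow> (real interval \<Rightarrow> real interval) \<Rightarrow>
   (real interval \<Rightarrow> real interval) \<Rightarrow> real interval set \<Rightarrow>
   (real interval \<times> real interval \<Rightarrow> real) \<Rightarrow> bool" where
  "partition_weight \<omega> f F DF \<I> w \<longleftrightarrow>
    (\<exists>(L :: real interval \<times> real interval \<Rightarrow> real interval) (b :: real interval \<Rightarrow> real).
      \<forall>(J, J')\<in>arcs (partition_graph F \<I>).
        set_of (L (J, J')) \<subseteq> set_of J \<and>
        {x \<in> set_of J. \<exists>a\<in>set_of \<omega>. f a x \<in> set_of J'} \<subseteq> set_of (L (J, J')) \<and>
        0 \<notin> set_of (DF (L (J, J'))) \<and>
        (\<forall>y\<in>set_of (DF (L (J, J'))). b (L (J, J')) \<le> ln \<bar>y\<bar>) \<and>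
        w (J, J') = b (L (J, J')))"


section \<open>Periodic orbits\<close>

text \<open>
  \<open>None\<close> stands for the result \<open>\<emptyset>\<close>. It is always possible, as the computation of an enclosure
  may fail. Success requires that \<open>f\<^sup>i(X)\<close> avoids \<open>\<Delta>\<close> for \<open>i = 1, \<dots>, n\<close>, so that the
  quantities below are then the intended ones although \<open>f\<close> is a total function.
\<close>

inductive periodic_orbit ::
  "(real \<Rightarrow> real) \<Rightarrow> (real \<Rightarrow> real) \<Rightarrow> real set \<Rightarrow> real interval \<Rightarrow> nat \<Rightarrow> real option \<Rightarrow> bool"
  for f Df \<Delta> X n where
  failure: "periodic_orbit f Df \<Delta> X n None"
| success: "periodic_orbit f Df \<Delta> X n (Some lmax)"
  if "x0 = (lower X + upper X) / 2"
    and "(f ^^ n) x0 \<in> set_of Fx0"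
    and "x0 - (f ^^ n) x0 \<in> set_of Gx0"
    and "\<forall>x\<in>set_of X. iter_deriv f Df n x \<in> set_of F'"
    and "\<forall>x\<in>set_of X. 1 - iter_deriv f Df n x \<in> set_of G'"
    and "0 \<notin> set_of G'"
    and "\<forall>y\<in>set_of Gx0. \<forall>z\<in>set_of G'. x0 - y / z \<in> set_of N"
    and "set_of N \<subseteq> interior (set_of X)"
    and "0 \<notin> set_of F'"
    and "\<forall>i\<in>{1..n}. (f ^^ i) ` set_of X \<subseteq> set_of (Fi i)"
    and "\<forall>i\<in>{1..n}. set_of (Fi i) \<inter> \<Delta> = {}"
    and "\<forall>x\<in>set_of X. ln \<bar>iter_deriv f Df n x\<bar> / real n \<le> lmax"
  for x0 lmax :: real and Fx0 Gx0 F' G' N :: "real interval" and Fi :: "nat \<Rightarrow> real interval"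


section \<open>Refinement and the expansion exponent\<close>

text \<open>
  \<open>split_loop R K Js \<I> \<I>' s full\<close>: bisecting the intervals \<open>Js\<close> in this order turns \<open>\<I>\<close> into
  \<open>\<I>'\<close>; \<open>s\<close> tells whether any interval was split, and \<open>full\<close> whether the loop was left because
  the cardinality became \<open>K\<close>. \<open>R\<close> is the set of computer-representable numbers.
\<close>

inductive split_loop ::
  "real set \<Rightarrow> nat \<Rightarrow> real interval list \<Rightarrow> real interval set \<Rightarrow> real interval set \<Rightarrow>
   bool \<Rightarrow> bool \<Rightarrow> bool"
  for R K where
  finished: "split_loop R K [] \<I> \<I> False False"
| skip: "split_loop R K (J # Js) \<I> \<I>' s full"
  if "is_arg_min (\<lambda>p. \<bar>p - (lower J + upper J) / 2\<bar>) (\<lambda>p. p \<in> R) p"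
    and "\<not> (lower J < p \<and> p < upper J)"
    and "split_loop R K Js \<I> \<I>' s full"
| split: "split_loop R K (J # Js) \<I> \<I>' True full"
  if "is_arg_min (\<lambda>p. \<bar>p - (lower J + upper J) / 2\<bar>) (\<lambda>p. p \<in> R) p"
    and "lower J < p" "p < upper J"
    and "\<I>\<^sub>1 = (\<I> - {J}) \<union> {Interval (lower J, p), Interval (p, upper J)}"
    and "if card \<I>\<^sub>1 = K then \<I>' = \<I>\<^sub>1 \<and> full else split_loop R K Js \<I>\<^sub>1 \<I>' s full"

text \<open>
  A state records the current partition, the values returned by the cycle mean computation in
  the runs of the loop made so far (latest first), and the pairs \<open>(a, \<lambda>\<^sub>m\<^sub>a\<^sub>x)\<close> returned so far by
  successful periodic orbit computations for \<open>f a\<close>.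
\<close>

datatype refine_state =
    Running (partition: "real interval set") (history: "ereal list")
      (orbit_bounds: "(real \<times> real) set")
  | Returned (partition: "real interval set") (orbit_bounds: "(real \<times> real) set")

locale expansion_algorithm =
  fixes I :: "real interval" and \<Delta> :: "real set" and \<omega> :: "real interval"
    and f Df :: "real \<Rightarrow> real \<Rightarrow> real"
    and F DF :: "real interval \<Rightarrow> real interval"
    and K :: nat
    and \<xi> :: real and n\<^sub>0 :: nat and \<eta> :: real
    and R :: "real set"
begin

definition cycle_vertices :: "(real interval \<times> real interval) list option \<Rightarrow> real interval set"
  where "cycle_vertices \<gamma> = (case \<gamma> of None \<Rightarrow> {} | Some c \<Rightarrow> fst ` set c)"

text \<open>
  How the cycle provides the candidate interval and the period is left open, and so is the choice
  of \<open>a\<close>; every valid input is admitted.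
\<close>

definition orbit_attempt ::
  "(real interval \<times> real interval) list option \<Rightarrow> (real \<times> real) set \<Rightarrow> bool" where
  "orbit_attempt \<gamma> B \<longleftrightarrow>
    (if \<gamma> \<noteq> None \<and> (\<forall>J\<in>cycle_vertices \<gamma>. width J < \<xi> * width I)
     then \<exists>a\<in>set_of \<omega>. \<exists>X n r. set_of X \<subseteq> set_of I - \<Delta> \<and> n > 0 \<and>
            periodic_orbit (f a) (Df a) \<Delta> X n r \<and> B = Pair a ` set_option r
     else B = {})"

inductive refine :: "real interval set \<Rightarrow> refine_state \<Rightarrow> bool" for \<I>\<^sub>0 where
  start: "refine \<I>\<^sub>0 (Running \<I>\<^sub>0 [] {})"
| exit: "refine \<I>\<^sub>0 (Returned \<I> B)"
  if "refine \<I>\<^sub>0 (Running \<I> h B)" "card \<I> > K"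
| run: "refine \<I>\<^sub>0
    (if full \<or> \<not> s \<or> (length (l # h) > n\<^sub>0 \<and> l \<le> ereal \<eta> * (l # h) ! n\<^sub>0)
     then Returned \<I>' (B \<union> B') else Running \<I>' (l # h) (B \<union> B'))"
  if "refine \<I>\<^sub>0 (Running \<I> h B)" "card \<I> \<le> K"
    and "partition_weight \<omega> f F DF \<I> w"
    and "min_cycle_mean (partition_graph F \<I>) w l \<gamma>"
    and "orbit_attempt \<gamma> B'"
    and "set Js = cycle_vertices \<gamma>" "distinct Js" "split_loop R K Js \<I> \<I>' s full"

text \<open>
  ``Approximately the same size'' has no precise meaning; no size restriction is imposed.
\<close>

definition initial_partition :: "real interval set \<Rightarrow> bool" where
  "initial_partition \<I>\<^sub>0 \<longleftrightarrow>
    admissible_partition I \<Delta> \<I>\<^sub>0 \<and> card \<I>\<^sub>0 = max 9 (card (components (set_of I - \<Delta>)))"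

definition expansion_exponent_returns :: "ereal \<Rightarrow> bool" where
  "expansion_exponent_returns l \<longleftrightarrow>
    (\<exists>\<I>\<^sub>0 \<I> B w \<gamma>. initial_partition \<I>\<^sub>0 \<and> refine \<I>\<^sub>0 (Returned \<I> B) \<and>
      partition_weight \<omega> f F DF \<I> w \<and> min_cycle_mean (partition_graph F \<I>) w l \<gamma>)"

text \<open>
  All reachable states are considered, not only final ones: a bound counts as obtained even if a
  later step of the computation fails.
\<close>

definition expansion_exponent_obtains :: "real \<Rightarrow> real \<Rightarrow> bool" where
  "expansion_exponent_obtains a lmax \<longleftrightarrow>
    (\<exists>\<I>\<^sub>0 S. initial_partition \<I>\<^sub>0 \<and> refine \<I>\<^sub>0 S \<and> (a, lmax) \<in> orbit_bounds S)"

end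

end

theory Submission
  imports Defs "Graph_Theory.Weighted_Graph"
begin

text \<open>
  The value \<open>r\<close> computed from the final partition is finite and at most the mean weight of every
  closed walk (Karp's theorem). Hence all closed walks have nonnegative cost for the weights
  \<open>w - r\<close>, and removing cycles bounds the cost of every walk from below by a constant. An orbit in
  \<open>I - \<Delta>\<close> follows a walk in the graph along which \<open>w\<close> is at most \<open>ln \<bar>Df\<bar>\<close>; the last point of the
  orbit, whose image may leave \<open>I - \<Delta>\<close>, contributes a factor bounded away from 0 by compactness.

  A successful periodic orbit computation is an interval Newton test, so \<open>f\<^sup>n\<close> has a fixed point in
  the interval. Its whole orbit avoids \<open>\<Delta>\<close>, and along it the derivative of the iterates grows
  exactly at the rate \<open>ln \<bar>(f\<^sup>n)'\<bar> / n \<le> \<lambda>\<^sub>m\<^sub>a\<^sub>x\<close>.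
\<close>

section \<open>Costs of walks\<close>

lemma (in wf_digraph) awalk_cost_shift:
  "awalk_cost (\<lambda>e. w e - r) p = awalk_cost w p - r * real (length p)"
  by (induction p) (auto simp: algebra_simps)

text \<open>Cutting out a closed subwalk cannot raise the cost when closed walks have nonnegative
  cost; repeating this leaves a walk without repeated vertices.\<close>

lemma (in wf_digraph) awalk_apath_cheaper:
  assumes "awalk u p v" and nonneg: "\<And>u z. awalk u z u \<Longrightarrow> 0 \<le> awalk_cost c z"
  shows "\<exists>q. apath u q v \<and> awalk_cost c q \<le> awalk_cost c p"
  using assms(1)
proof (induction rule: awalk_to_apath_induct)
  case (path p)
  then show ?case by (auto simp: apath_def)
next
  case (decomp p q r s)
  obtain x where "p = q @ r @ s" "awalk x r x"
    using decomp by (elim awalk_cyc_decompE) auto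
  then have "awalk_cost c (q @ s) \<le> awalk_cost c p"
    using nonneg by auto
  then show ?case using decomp.IH by force
qed

text \<open>A finite digraph has only finitely many walks without repeated vertices, and by
  \<open>awalk_apath_cheaper\<close> the cheapest of them bounds all walks.\<close>

lemma (in fin_digraph) awalk_cost_bdd_below:
  assumes "\<And>u z. awalk u z u \<Longrightarrow> 0 \<le> awalk_cost c z"
  shows "\<exists>B. \<forall>u p v. awalk u p v \<longrightarrow> B \<le> awalk_cost c p"
proof -
  let ?S = "(\<lambda>(u, p, v). awalk_cost c p) ` {(u, p, v). apath u p v}"
  have "bdd_below ?S"
    using apaths_finite_triple by (intro bdd_below_finite) auto
  then obtain B where B: "\<And>y. y \<in> ?S \<Longrightarrow> B \<le> y"
    unfolding bdd_below_def by blast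
  have "B \<le> awalk_cost c p" if p: "awalk u p v" for u p v
  proof -
    obtain q where q: "apath u q v" "awalk_cost c q \<le> awalk_cost c p"
      using awalk_apath_cheaper[OF p] assms by blast
    have "awalk_cost c q \<in> ?S" using q(1) by force
    then show ?thesis using B q(2) by fastforce
  qed
  then show ?thesis by blast
qed

text \<open>A closed walk with more arcs than there are vertices splits at a repeated vertex into
  two shorter closed walks. If both had mean at least r, so would the whole walk.\<close>

lemma (in fin_digraph) short_closed_awalk:
  assumes "awalk u p u" "p \<noteq> []" "awalk_cost w p < r * real (length p)"
  shows "\<exists>v q. awalk v q v \<and> q \<noteq> [] \<and> length q \<le> card (verts G) \<and>
    awalk_cost w q < r * real (length q)"
  using assms
proof (induction "length p" arbitrary: u p rule: less_induct)
  case less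
  show ?case
  proof (cases "length p \<le> card (verts G)")
    case False
    \<comment> \<open>Every closed walk repeats its end point, which by itself yields no proper
      splitting. With the first arc set aside, both pieces \<open>z\<close> and
      \<open>e # q @ s\<close> are nonempty and strictly shorter than \<open>p\<close>.\<close>
    obtain e es where p: "p = e # es" using less.prems(2) by (cases p) auto
    with less.prems(1) have es: "awalk (head G e) es u" using awalk_Cons_iff by metis
    have "\<not> distinct (awalk_verts (head G e) es)"
    proof
      assume "distinct (awalk_verts (head G e) es)"
      then have "length es < card (verts G)"
        using es length_apath_less by (auto simp: apath_def)
      then show False using False p by simp
    qed
    then obtain q x z s where d: "es = q @ z @ s" "0 < length z"
        "awalk (head G e) q x" "awalk x z x" "awalk x s u"
      using awalk_not_distinct_decomp[OF es] by metis
    have rest: "awalk u (e # q @ s) u"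
      using less.prems(1) awalk_appendI[OF d(3,5)] unfolding p awalk_Cons_iff by blast
    have "awalk_cost w z < r * real (length z) \<or>
        awalk_cost w (e # q @ s) < r * real (length (e # q @ s))"
      using less.prems(3) by (auto simp: p d(1) algebra_simps)
    then show ?thesis
    proof
      assume "awalk_cost w z < r * real (length z)"
      then show ?thesis using less.hyps[of z x] d by (auto simp: p)
    next
      assume "awalk_cost w (e # q @ s) < r * real (length (e # q @ s))"
      then show ?thesis using less.hyps[OF _ rest] d by (auto simp: p)
    qed
  qed (use less.prems in blast)
qed

text \<open>By \<open>short_closed_awalk\<close> it suffices to minimise the mean over the finitely
  many closed walks with at most \<open>card (verts G)\<close> arcs.\<close>

lemma (in fin_digraph) min_closed_awalk:
  assumes "awalk u p u" "p \<noteq> []"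
  obtains v z r where "awalk v z v" "z \<noteq> []" "awalk_cost w z = r * real (length z)"
    "\<And>x q. awalk x q x \<Longrightarrow> r * real (length q) \<le> awalk_cost w q"
proof -
  let ?Z = "{q. q \<noteq> [] \<and> length q \<le> card (verts G) \<and> (\<exists>v. awalk v q v)}"
  let ?mean = "\<lambda>q. awalk_cost w q / real (length q)"
  have "?Z \<subseteq> {q. set q \<subseteq> arcs G \<and> length q \<le> card (verts G)}" by auto
  then have fin: "finite ?Z" by (rule finite_subset) (intro finite_lists_length_le finite_arcs)
  \<comment> \<open>Any bound above the mean of \<open>p\<close> would do;
    \<open>short_closed_awalk\<close> then provides a short closed walk.\<close>
  have ne: "?Z \<noteq> {}"
  proof -
    have "awalk_cost w p < (?mean p + 1) * real (length p)"
      using assms(2) by (simp add: field_simps)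
    from short_closed_awalk[OF assms this] show ?thesis by blast
  qed
  obtain z where z: "z \<in> ?Z" and min: "\<And>q. q \<in> ?Z \<Longrightarrow> ?mean z \<le> ?mean q"
    using ex_is_arg_min_if_finite[OF fin ne, of ?mean] by (auto simp: is_arg_min_linorder)
  have "?mean z * real (length q) \<le> awalk_cost w q" if q: "awalk x q x" for x q
  proof (rule ccontr)
    assume neg: "\<not> ?thesis"
    then have "q \<noteq> []" by auto
    then obtain v q' where "awalk v q' v" "q' \<noteq> []" "length q' \<le> card (verts G)"
        "awalk_cost w q' < ?mean z * real (length q')"
      using short_closed_awalk[OF q _ neg[unfolded not_le]] by blast
    then show False using min[of q'] by (auto simp: field_simps)
  qed
  then show ?thesis using z that[of _ z "?mean z"] by auto
qed

section \<open>Cheapest walks of prescribed length\<close>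

lemma (in wf_digraph) awalk_power:
  "awalk u p u \<Longrightarrow> awalk u (concat (replicate n p)) u"
  by (induction n) (auto simp: awalk_Nil_iff intro: awalk_appendI simp del: awalk_append_iff)

lemma (in wf_digraph) awalk_cost_power:
  "awalk_cost c (concat (replicate n p)) = real n * awalk_cost c p"
  by (induction n) (auto simp: algebra_simps)

lemma (in wf_digraph) awalk_append_awlastE:
  assumes "awalk u (p @ q) v"
  obtains x where "awalk u p x" "awalk x q v"
  using assms by auto

text \<open>
  Winding around a closed walk of cost 0 after a cheapest walk never stops being cheapest,
  which gives cheapest walks of arbitrary length.
\<close>

lemma (in fin_digraph) cheapest_awalk_of_length:
  assumes nonneg: "\<And>u z. awalk u z u \<Longrightarrow> 0 \<le> awalk_cost c z"
    and z: "awalk x z x" "z \<noteq> []" "awalk_cost c z = 0" and "s \<rightarrow>\<^sup>* x"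
  shows "\<exists>v q. awalk s q v \<and> length q = n \<and>
    (\<forall>q'. awalk s q' v \<longrightarrow> awalk_cost c q \<le> awalk_cost c q')"
proof -
  have fin: "finite {p. apath s p x}" by (rule apaths_finite)
  have ne: "{p. apath s p x} \<noteq> {}" using assms(5) reachable_apath by auto
  obtain p where p: "apath s p x" and "\<And>q. apath s q x \<Longrightarrow> awalk_cost c p \<le> awalk_cost c q"
    using ex_is_arg_min_if_finite[OF fin ne, of "awalk_cost c"]
    by (auto simp: is_arg_min_linorder)
  then have p_min: "awalk_cost c p \<le> awalk_cost c q" if "awalk s q x" for q
    using awalk_apath_cheaper[OF that] nonneg by (meson order_trans)
  define W where "W = p @ concat (replicate n z)"
  have W: "awalk s W x" "awalk_cost c W = awalk_cost c p"
    using p z awalk_power[OF z(1)]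
    by (auto simp: W_def apath_def awalk_cost_power intro: awalk_appendI simp del: awalk_append_iff)
  have len: "length W \<ge> n"
  proof -
    have "n * 1 \<le> n * length z" using z(2) by (intro mult_le_mono2) (cases z, auto)
    then have "n \<le> n * length z" by simp
    then show ?thesis by (simp add: W_def length_concat sum_list_replicate trans_le_add2)
  qed
  obtain v where v: "awalk s (take n W) v" "awalk v (drop n W) x"
    using W(1) awalk_append_awlastE[of s "take n W" "drop n W" x] by auto
  \<comment> \<open>A prefix of a cheapest walk is cheapest: a cheaper walk to \<open>v\<close>,
    continued by the rest of \<open>W\<close>, would reach \<open>x\<close> at a lower cost than
    \<open>p\<close>.\<close>
  have "awalk_cost c (take n W) \<le> awalk_cost c q'" if "awalk s q' v" for q'
  proof -
    have "awalk_cost c (take n W) + awalk_cost c (drop n W) = awalk_cost c p"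
      using W(2) by (simp flip: awalk_cost_append)
    also have "\<dots> \<le> awalk_cost c (q' @ drop n W)"
      using that v by (intro p_min awalk_appendI)
    finally show ?thesis by simp
  qed
  with v(1) len show ?thesis by (intro exI[of _ v] exI[of _ "take n W"]) auto
qed

section \<open>Karp's theorem\<close>

text \<open>\<open>karp_F\<close> reads arcs as pairs of vertices, so tail and head are fixed to be
  the projections. The locale is used both for the partition graph and for its strongly connected
  components.\<close>

locale fin_pair_digraph = fin_digraph G for G :: "'v digraph" +
  assumes tail_eq: "tail G = fst" and head_eq: "head G = snd"
begin

lemma awalk_snoc_iff: "awalk u (p @ [(x, v)]) v' \<longleftrightarrow> awalk u p x \<and> (x, v) \<in> arcs G \<and> v' = v"
  using wellformed[of "(x, v)"] by (auto simp: awalk_Cons_iff awalk_Nil_iff tail_eq head_eq)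

lemma awalk_sequence:
  assumes "J 0 \<in> verts G" "\<And>i. i < m \<Longrightarrow> (J i, J (Suc i)) \<in> arcs G"
  shows "awalk (J 0) (map (\<lambda>i. (J i, J (Suc i))) [0..<m]) (J m)"
  using assms(2)
proof (induction m)
  case (Suc m)
  then show ?case by (simp add: awalk_snoc_iff del: awalk_append_iff)
qed (simp add: awalk_Nil_iff assms(1))

text \<open>With \<open>karp_F_attained\<close> this identifies \<open>karp_F G w s k v\<close> as
  the least cost of a walk from \<open>s\<close> to \<open>v\<close> with exactly k arcs.\<close>

lemma karp_F_le:
  "awalk s p v \<Longrightarrow> karp_F G w s (length p) v \<le> ereal (awalk_cost w p)"
proof (induction p arbitrary: v rule: rev_induct)
  case Nil
  then show ?case by (auto simp: awalk_Nil_iff)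
next
  case (snoc e p)
  obtain x y where e: "e = (x, y)" by fastforce
  with snoc.prems have p: "awalk s p x" "(x, v) \<in> arcs G" "y = v"
    by (auto simp only: awalk_snoc_iff)
  have "karp_F G w s (length (p @ [e])) v \<le> karp_F G w s (length p) x + ereal (w (x, v))"
    using p by (auto intro: INF_lower)
  also have "\<dots> \<le> ereal (awalk_cost w p) + ereal (w (x, v))"
    using snoc.IH[OF p(1)] by (rule add_right_mono)
  finally show ?case using e p by simp
qed

lemma karp_F_attained:
  assumes "s \<in> verts G" "karp_F G w s k v < \<infinity>"
  obtains p where "awalk s p v" "length p = k" "karp_F G w s k v = ereal (awalk_cost w p)"
  using assms(2)
proof (induction k arbitrary: v thesis)
  case 0
  then have "v = s" by (auto split: if_splits)
  then show ?case using 0(1)[of "[]"] assms(1) by (simp add: awalk_Nil_iff)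
next
  case (Suc k)
  let ?U = "{u. (u, v) \<in> arcs G}" and ?g = "\<lambda>u. karp_F G w s k u + ereal (w (u, v))"
  have "finite ?U"
    by (rule finite_subset[of _ "fst ` arcs G"]) (auto intro: rev_image_eqI)
  \<comment> \<open>Without predecessors the infimum would be the top element \<infinity>.\<close>
  moreover have "?U \<noteq> {}" using Suc.prems(2) by (intro notI) (simp add: top_ereal_def)
  ultimately have "Inf (?g ` ?U) \<in> ?g ` ?U"
    using Min_in[of "?g ` ?U"] Min_Inf[of "?g ` ?U"] by simp
  then obtain u where u: "(u, v) \<in> arcs G" "karp_F G w s (Suc k) v = ?g u" by auto
  with Suc.prems(2) have "karp_F G w s k u < \<infinity>" by auto
  then obtain p where "awalk s p u" "length p = k" "karp_F G w s k u = ereal (awalk_cost w p)"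
    using Suc.IH by blast
  then show ?case
    using u by (intro Suc.prems(1)[of "p @ [(u, v)]"]) (auto simp only: awalk_snoc_iff, auto)
qed

lemma karp_F_not_MInf: "s \<in> verts G \<Longrightarrow> karp_F G w s k v \<noteq> -\<infinity>"
  by (rule notI, rule karp_F_attained[of s w k v]) auto

text \<open>No quotient is \<infinity>, since \<open>karp_F\<close> never takes the value
  -\<infinity>. The maximum is not -\<infinity> either: removing cycles from a walk to
  \<open>v\<close> leaves one with fewer than n arcs, so at least one of the subtracted values is
  finite.\<close>

lemma karp_M_real:
  assumes s: "s \<in> verts G" and v: "karp_F G w s (card (verts G)) v < \<infinity>"
  obtains r where "karp_M G w s v = ereal r"
proof -
  let ?n = "card (verts G)"
  let ?t = "\<lambda>k. (karp_F G w s ?n v - karp_F G w s k v) / ereal (real (?n - k))"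
  obtain p where p: "awalk s p v" "karp_F G w s ?n v = ereal (awalk_cost w p)"
    using karp_F_attained[OF s v] by blast
  define q where "q = awalk_to_apath p"
  have q: "apath s q v" using apath_awalk_to_apath[OF p(1)] by (simp add: q_def)
  then have len: "length q < ?n" by (rule length_apath_less)
  have not_PInf: "?t k < \<infinity>" if "k < ?n" for k
  proof -
    have "karp_F G w s k v \<noteq> -\<infinity>" using karp_F_not_MInf[OF s] .
    then show ?thesis using that
      by (cases "karp_F G w s k v") (auto simp: p(2))
  qed
  have "karp_F G w s (length q) v \<le> ereal (awalk_cost w q)"
    using q by (intro karp_F_le) (simp add: apath_def)
  then obtain y where "karp_F G w s (length q) v = ereal y"
    using karp_F_not_MInf[OF s, of w "length q" v]
    by (cases "karp_F G w s (length q) v") auto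
  then have "-\<infinity> < ?t (length q)" using len by (simp add: p(2))
  also have "?t (length q) \<le> karp_M G w s v"
    using len by (auto simp: karp_M_def Let_def intro!: Max_ge)
  finally have "-\<infinity> < karp_M G w s v" .
  moreover have "karp_M G w s v < \<infinity>"
  proof -
    have "karp_M G w s v \<in> ?t ` {0..?n - 1}"
      unfolding karp_M_def Let_def by (intro Max_in) auto
    then show ?thesis using not_PInf len by fastforce
  qed
  ultimately show ?thesis using that by (cases "karp_M G w s v") auto
qed

text \<open>Let r be the least mean and n the number of vertices. For the weights w - r, some walk
  with exactly n arcs is cheapest among all walks from s to its end v. Hence F_n(v) - n r \<le>
  F_k(v) - k r for every k < n, so each quotient in M(v) is at most r.\<close>

lemma karp_M_le_mean:
  assumes sc: "strongly_connected G" and s: "s \<in> verts G" and p: "awalk u p u" "p \<noteq> []"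
  obtains v where "v \<in> verts G" "karp_F G w s (card (verts G)) v < \<infinity>"
    "karp_M G w s v \<le> ereal (awalk_cost w p / real (length p))"
proof -
  let ?n = "card (verts G)"
  have n: "?n > 0" using s by (auto simp: card_gt_0_iff)
  obtain x z r where z: "awalk x z x" "z \<noteq> []" "awalk_cost w z = r * real (length z)"
    and r: "\<And>x q. awalk x q x \<Longrightarrow> r * real (length q) \<le> awalk_cost w q"
    using min_closed_awalk[OF p, of w] by blast
  let ?c = "\<lambda>e. w e - r"
  \<comment> \<open>Strong connectivity makes the optimal closed walk reachable from
    \<open>s\<close>, whichever start vertex was chosen.\<close>
  have reach: "s \<rightarrow>\<^sup>*\<^bsub>G\<^esub> x" using sc s z(1) by (auto elim: strongly_connectedE)
  have nonneg: "0 \<le> awalk_cost ?c q" if "awalk y q y" for y q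
    using r[OF that] by (simp add: awalk_cost_shift)
  have zero: "awalk_cost ?c z = 0" using z(3) by (simp add: awalk_cost_shift)
  have "\<exists>v q. awalk s q v \<and> length q = ?n \<and>
      (\<forall>q'. awalk s q' v \<longrightarrow> awalk_cost ?c q \<le> awalk_cost ?c q')"
    by (rule cheapest_awalk_of_length[OF _ z(1,2) zero reach]) (rule nonneg)
  then obtain v q where q: "awalk s q v" "length q = ?n"
    and q_min: "\<And>q'. awalk s q' v \<Longrightarrow> awalk_cost ?c q \<le> awalk_cost ?c q'"
    by blast
  have Fn: "karp_F G w s ?n v \<le> ereal (awalk_cost w q)"
    using karp_F_le[OF q(1)] q(2) by simp
  then obtain y where y: "karp_F G w s ?n v = ereal y" "y \<le> awalk_cost w q"
    using karp_F_not_MInf[OF s, of w ?n v] by (cases "karp_F G w s ?n v") auto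
  have "(karp_F G w s ?n v - karp_F G w s k v) / ereal (real (?n - k)) \<le> ereal r" if k: "k < ?n" for k
  proof (cases "karp_F G w s k v < \<infinity>")
    case True
    then obtain q' where q': "awalk s q' v" "length q' = k"
        "karp_F G w s k v = ereal (awalk_cost w q')"
      using karp_F_attained[OF s] by metis
    have "awalk_cost w q - r * real ?n \<le> awalk_cost w q' - r * real k"
      using q_min[OF q'(1)] q(2) q'(2) by (simp add: awalk_cost_shift)
    then show ?thesis
      using k y(2) by (simp add: y(1) q'(3) divide_simps of_nat_diff algebra_simps)
  next
    case False
    then show ?thesis using k by (simp add: y(1))
  qed
  then have "karp_M G w s v \<le> ereal r"
    using n by (auto simp: karp_M_def Let_def intro!: Max.boundedI)
  moreover have "r \<le> awalk_cost w p / real (length p)"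
    using r[OF p(1)] p(2) by (simp add: field_simps)
  ultimately show ?thesis
    using q(1) y(1) by (intro that[of v]) (auto intro: order_trans)
qed

text \<open>The vertex given by \<open>karp_M_le_mean\<close> may depend on the closed walk, but the
  minimiser of M does at least as well as each of them, so one r serves all closed walks.\<close>

lemma min_cycle_mean_sc_le:
  assumes "strongly_connected G" "min_cycle_mean_sc G w l \<gamma>"
  obtains r where "l = ereal r" "\<And>u p. awalk u p u \<Longrightarrow> r * real (length p) \<le> awalk_cost w p"
proof -
  let ?n = "card (verts G)"
  obtain s x where s: "s \<in> verts G" and l: "l = karp_M G w s x"
    and x: "is_arg_min (karp_M G w s) (\<lambda>v. v \<in> verts G \<and> karp_F G w s ?n v < \<infinity>) x"
    using assms(2) by (auto simp: min_cycle_mean_sc_def Let_def)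
  from x have "karp_F G w s ?n x < \<infinity>" by (simp add: is_arg_min_def)
  then obtain r where r: "l = ereal r" using karp_M_real[OF s] l by metis
  have "r * real (length p) \<le> awalk_cost w p" if p: "awalk u p u" for u p
  proof (cases "p = []")
    case False
    obtain v where "v \<in> verts G" "karp_F G w s ?n v < \<infinity>"
        "karp_M G w s v \<le> ereal (awalk_cost w p / real (length p))"
      by (rule karp_M_le_mean[OF assms(1) s p False])
    moreover from this have "l \<le> karp_M G w s v"
      using x by (auto simp: l is_arg_min_linorder)
    ultimately have "r \<le> awalk_cost w p / real (length p)"
      using r by (metis ereal_less_eq(3) order_trans)
    then show ?thesis using False by (simp add: field_simps)
  qed simp
  with r show ?thesis using that by blast
qed

section \<open>From strongly connected components to the whole digraph\<close>

lemma induced_fin_pair_digraph: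
  assumes "induced_subgraph H G"
  shows "fin_pair_digraph H"
proof -
  have sub: "subgraph H G" using assms by (rule induced_imp_subgraph)
  then have "tail H = tail G" "head H = head G"
    by (auto simp: subgraph_def compatible_def)
  then show ?thesis
    using fin_digraph_subgraph[OF sub]
    by (simp add: fin_pair_digraph_def fin_pair_digraph_axioms_def tail_eq head_eq)
qed

text \<open>Each vertex on the walk is reachable from \<open>u\<close> and reaches \<open>u\<close>,
  so the walk stays in the component of \<open>u\<close>.\<close>

lemma closed_awalk_in_scc:
  assumes "awalk u p u" "p \<noteq> []"
  obtains H where "H \<in> sccs" "arcs H \<noteq> {}" "pre_digraph.awalk H u p u"
proof
  let ?H = "G \<restriction> scc_of u"
  have u: "u \<in> verts G" using assms(1) by auto
  show "?H \<in> sccs" using u by (intro in_verts_sccsD_sccs scc_of_in_sccs_verts)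
  have in_scc: "v \<in> scc_of u" if "v \<in> set (awalk_verts u p)" for v
    using awalk_verts_reachable_from[OF assms(1) that] awalk_verts_reachable_to[OF assms(1) that]
    by (simp add: scc_of_def)
  have arcs: "set p \<subseteq> arcs ?H"
  proof
    fix e assume "e \<in> set p"
    then show "e \<in> arcs ?H"
      using assms(1) in_scc awalk_verts_arc1 awalk_verts_arc2[OF assms(1)] by auto
  qed
  then show "arcs ?H \<noteq> {}" using assms(2) by (cases p) auto
  show "pre_digraph.awalk ?H u p u"
    using arcs assms(1) in_scc_of_self[OF u]
    by (auto simp: pre_digraph.awalk_def compatible_cas[OF compatible_induce_subgraph])
qed

text \<open>Every closed walk lies in a single component, whose value bounds its mean from below;
  the smallest of these values serves for all.\<close>

lemma min_cycle_mean_le: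
  assumes "min_cycle_mean G w l \<gamma>" "l \<noteq> \<infinity>"
  obtains r where "l = ereal r" "\<And>u p. awalk u p u \<Longrightarrow> r * real (length p) \<le> awalk_cost w p"
proof -
  let ?C = "{H \<in> sccs. arcs H \<noteq> {}}"
  obtain lH \<gamma>H H where H: "H \<in> ?C" "l = lH H" and min: "\<And>H'. H' \<in> ?C \<Longrightarrow> lH H \<le> lH H'"
    and sc: "\<And>H. H \<in> ?C \<Longrightarrow> min_cycle_mean_sc H w (lH H) (\<gamma>H H)"
    using assms by (auto simp: min_cycle_mean_def Let_def is_arg_min_linorder split: if_splits)
  have *: "\<exists>r. lH H = ereal r \<and>
      (\<forall>u p. pre_digraph.awalk H u p u \<longrightarrow> r * real (length p) \<le> awalk_cost w p)"
    if HC: "H \<in> ?C" for H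
  proof -
    interpret H: fin_pair_digraph H
      using HC induced_fin_pair_digraph by auto
    have "strongly_connected H" using HC by auto
    then obtain r where "lH H = ereal r"
        "\<And>u p. H.awalk u p u \<Longrightarrow> r * real (length p) \<le> awalk_cost w p"
      using H.min_cycle_mean_sc_le[OF _ sc[OF HC]] by blast
    then show ?thesis by blast
  qed
  obtain r where r: "l = ereal r" using *[OF H(1)] H(2) by auto
  have "r * real (length p) \<le> awalk_cost w p" if p: "awalk u p u" for u p
  proof (cases "p = []")
    case False
    obtain H' where "H' \<in> sccs" "arcs H' \<noteq> {}" and aw: "pre_digraph.awalk H' u p u"
      by (rule closed_awalk_in_scc[OF p False])
    then have H': "H' \<in> ?C" by simp
    with * aw obtain r' where "lH H' = ereal r'" "r' * real (length p) \<le> awalk_cost w p"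
      by blast
    moreover from this have "r \<le> r'" using min[OF H'] unfolding H(2)[symmetric] r by simp
    ultimately show ?thesis by (meson mult_right_mono of_nat_0_le_iff order_trans)
  qed simp
  with r show ?thesis using that by blast
qed

text \<open>Ensures that the intervals chosen for bisection belong to the current partition.\<close>

lemma min_cycle_mean_cycle_arcs:
  assumes "min_cycle_mean G w l (Some \<gamma>)"
  shows "set \<gamma> \<subseteq> arcs G"
proof -
  obtain lH \<gamma>H H where H: "H \<in> sccs" "arcs H \<noteq> {}" "\<gamma> = \<gamma>H H"
    and sc: "\<forall>H\<in>{H \<in> sccs. arcs H \<noteq> {}}. min_cycle_mean_sc H w (lH H) (\<gamma>H H)"
    using assms by (auto simp: min_cycle_mean_def Let_def is_arg_min_def split: if_splits)
  then have "min_cycle_mean_sc H w (lH H) \<gamma>" by auto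
  then have "closed_path H \<gamma>" by (auto simp: min_cycle_mean_sc_def Let_def)
  moreover have "arcs H \<subseteq> arcs G"
    using in_sccs_imp_induced[OF H(1)] by (auto dest: induced_imp_subgraph)
  ultimately show ?thesis
    by (auto simp: closed_path_def pre_digraph.awalk_def)
qed

end

section \<open>Invariants of the refinement\<close>

lemma partition_graph_simps [simp]:
  "verts (partition_graph F P) = P"
  "arcs (partition_graph F P) =
    {(J, J'). J \<in> P \<and> J' \<in> P \<and> set_of (F J) \<inter> set_of J' \<noteq> {}}"
  "tail (partition_graph F P) = fst" "head (partition_graph F P) = snd"
  by (auto simp: partition_graph_def)

lemma fin_pair_digraph_partition_graph:
  assumes "finite P"
  shows "fin_pair_digraph (partition_graph F P)"
proof
  show "finite (arcs (partition_graph F P))"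
    by (rule finite_subset[of _ "P \<times> P"]) (use assms in auto)
qed (use assms in auto)

text \<open>The loop invariant: pieces inside \<open>S\<close> keep the enclosures by
  \<open>F\<close> and \<open>DF\<close> applicable, and the covering property assigns a vertex to
  every orbit point in \<open>S\<close>.\<close>

definition subordinate_cover :: "real set \<Rightarrow> real interval set \<Rightarrow> bool" where
  "subordinate_cover S P \<longleftrightarrow> finite P \<and> (\<forall>J\<in>P. set_of J \<subseteq> S) \<and> S \<subseteq> (\<Union>J\<in>P. set_of J)"

lemma set_of_Interval: "a \<le> b \<Longrightarrow> set_of (Interval (a, b)) = {a..b}"
  by (simp add: set_of.rep_eq Interval_inverse)

text \<open>The condition on \<open>J\<close> is stated relative to \<open>S\<close> rather than
  \<open>P\<close>, so it survives earlier splits of the same pass without bookkeeping.\<close>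

lemma subordinate_cover_bisect:
  assumes P: "subordinate_cover S P" and J: "set_of J \<subseteq> S" and p: "lower J < p" "p < upper J"
  shows "subordinate_cover S ((P - {J}) \<union> {Interval (lower J, p), Interval (p, upper J)})"
proof -
  have J_eq: "set_of J = set_of (Interval (lower J, p)) \<union> set_of (Interval (p, upper J))"
    using p by (auto simp: set_of_Interval set_of_eq[of J])
  have "S \<subseteq> (\<Union>J'\<in>P. set_of J')" using P by (simp add: subordinate_cover_def)
  also have "\<dots> \<subseteq> (\<Union>J'\<in>(P - {J}) \<union> {J}. set_of J')" by blast
  also have "\<dots> = (\<Union>J'\<in>(P - {J}) \<union> {Interval (lower J, p), Interval (p, upper J)}. set_of J')"
    by (simp only: UN_Un UN_insert UN_empty J_eq Un_empty_right)
  finally show ?thesis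
    using P J J_eq by (auto simp: subordinate_cover_def)
qed

lemma split_loop_subordinate_cover:
  assumes "split_loop R K Js P P' s full"
  shows "subordinate_cover S P \<Longrightarrow> (\<And>J. J \<in> set Js \<Longrightarrow> set_of J \<subseteq> S) \<Longrightarrow> subordinate_cover S P'"
  using assms
proof (induction rule: split_loop.induct)
  case (split J p P1 P P' full Js s)
  then have "subordinate_cover S P1" using subordinate_cover_bisect by simp
  with split show ?case by (auto split: if_splits)
qed auto

context expansion_algorithm
begin

text \<open>A property of the pair alone, without reference to a state, so it persists however the
  refinement continues.\<close>

definition certified_orbit_bound :: "real \<Rightarrow> real \<Rightarrow> bool" where
  "certified_orbit_bound a lmax \<longleftrightarrow> a \<in> set_of \<omega> \<and>
    (\<exists>X n. set_of X \<subseteq> set_of I - \<Delta> \<and> n > 0 \<and> periodic_orbit (f a) (Df a) \<Delta> X n (Some lmax))"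

lemma refine_invariant:
  assumes "refine P0 S" "subordinate_cover (set_of I - \<Delta>) P0"
  shows "subordinate_cover (set_of I - \<Delta>) (partition S) \<and>
    (\<forall>(a, lmax)\<in>orbit_bounds S. certified_orbit_bound a lmax)"
  using assms(1)
proof (induction rule: refine.induct)
  case (run P h B w l \<gamma> B' Js P' s full)
  from run.IH have P: "subordinate_cover (set_of I - \<Delta>) P"
    and B: "\<forall>(a, lmax)\<in>B. certified_orbit_bound a lmax" by simp_all
  interpret fin_pair_digraph "partition_graph F P"
    using P by (intro fin_pair_digraph_partition_graph) (simp add: subordinate_cover_def)
  \<comment> \<open>This places the intervals to be split inside
    \<open>set_of I - \<Delta>\<close>.\<close>
  have "cycle_vertices \<gamma> \<subseteq> P"
  proof (cases \<gamma>)
    case (Some c)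
    then have "set c \<subseteq> arcs (partition_graph F P)"
      using run.hyps(4) by (intro min_cycle_mean_cycle_arcs) simp
    with Some show ?thesis by (auto simp: cycle_vertices_def)
  qed (simp add: cycle_vertices_def)
  then have "set_of J \<subseteq> set_of I - \<Delta>" if "J \<in> set Js" for J
    using that run.hyps(6) P unfolding subordinate_cover_def by blast
  then have "subordinate_cover (set_of I - \<Delta>) P'"
    using split_loop_subordinate_cover[OF run.hyps(8) P] by blast
  moreover have "\<forall>(a, lmax)\<in>B'. certified_orbit_bound a lmax"
    using run.hyps(5) by (auto simp: orbit_attempt_def certified_orbit_bound_def split: if_splits)
  ultimately show ?case using B by auto
qed (use assms(2) in auto)

lemma initial_partition_subordinate_cover:
  "initial_partition P \<Longrightarrow> subordinate_cover (set_of I - \<Delta>) P"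
  by (simp add: initial_partition_def admissible_partition_def subordinate_cover_def)

lemma expansion_exponent_returnsE:
  assumes "expansion_exponent_returns l"
  obtains P w \<gamma> where "subordinate_cover (set_of I - \<Delta>) P"
    "partition_weight \<omega> f F DF P w" "min_cycle_mean (partition_graph F P) w l \<gamma>"
proof -
  obtain P0 P B w \<gamma> where "initial_partition P0" "refine P0 (Returned P B)"
      and w: "partition_weight \<omega> f F DF P w" "min_cycle_mean (partition_graph F P) w l \<gamma>"
    using assms unfolding expansion_exponent_returns_def by (elim exE conjE) (rule that)
  then have "subordinate_cover (set_of I - \<Delta>) P"
    using refine_invariant[of P0 "Returned P B"] initial_partition_subordinate_cover by simp
  then show ?thesis using w by (rule that)
qed

lemma expansion_exponent_obtains_certified:
  assumes "expansion_exponent_obtains a lmax"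
  shows "certified_orbit_bound a lmax"
  using assms initial_partition_subordinate_cover refine_invariant
  unfolding expansion_exponent_obtains_def by fastforce

end

section \<open>Bounds on the expansion exponent\<close>

lemma iter_deriv_Suc: "iter_deriv f Df (Suc n) x = iter_deriv f Df n x * Df ((f ^^ n) x)"
  by (simp add: iter_deriv_def)

text \<open>The product over k n steps consists of k turns around the orbit, each contributing the
  same factor.\<close>

lemma iter_deriv_periodic:
  assumes "(f ^^ n) x = x"
  shows "iter_deriv f Df (k * n) x = iter_deriv f Df n x ^ k"
proof (induction k)
  case (Suc k)
  have "iter_deriv f Df (Suc k * n) x =
      (\<Prod>i\<in>{..<k * n} \<union> {k * n..<k * n + n}. Df ((f ^^ i) x))"
    unfolding iter_deriv_def by (rule prod.cong) auto
  also have "\<dots> = iter_deriv f Df (k * n) x * (\<Prod>i\<in>{k * n..<k * n + n}. Df ((f ^^ i) x))"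
    unfolding iter_deriv_def by (rule prod.union_disjoint) auto
  also have "(\<Prod>i\<in>{k * n..<k * n + n}. Df ((f ^^ i) x)) = (\<Prod>i<n. Df ((f ^^ (i + k * n)) x))"
    using prod.shift_bounds_nat_ivl[of "\<lambda>i. Df ((f ^^ i) x)" 0 "k * n" n]
    by (simp add: atLeast0LessThan add.commute)
  also have "\<dots> = iter_deriv f Df n x"
  proof -
    have "(f ^^ (k * n)) x = x" for k
      using assms by (induction k) (auto simp: funpow_add)
    then show ?thesis by (simp add: iter_deriv_def funpow_add)
  qed
  finally show ?case using Suc.IH by simp
qed (simp add: iter_deriv_def)

text \<open>The interval \<open>L (J, J')\<close> contains every point of \<open>J\<close> that some
  parameter sends into \<open>J'\<close>, so \<open>DF\<close> of it encloses the derivative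
  there.\<close>

lemma partition_weight_le:
  assumes w: "partition_weight \<omega> f F DF P w"
    and DF: "\<And>J. set_of J \<subseteq> S \<Longrightarrow> {Df a x | a x. a \<in> set_of \<omega> \<and> x \<in> set_of J} \<subseteq> set_of (DF J)"
    and e: "(J, J') \<in> arcs (partition_graph F P)"
    and x: "a \<in> set_of \<omega>" "set_of J \<subseteq> S" "x \<in> set_of J" "f a x \<in> set_of J'"
  shows "w (J, J') \<le> ln \<bar>Df a x\<bar>"
proof -
  obtain L b where *: "\<forall>(J, J')\<in>arcs (partition_graph F P).
        set_of (L (J, J')) \<subseteq> set_of J \<and>
        {x \<in> set_of J. \<exists>a\<in>set_of \<omega>. f a x \<in> set_of J'} \<subseteq> set_of (L (J, J')) \<and>
        0 \<notin> set_of (DF (L (J, J'))) \<and>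
        (\<forall>y\<in>set_of (DF (L (J, J'))). b (L (J, J')) \<le> ln \<bar>y\<bar>) \<and>
        w (J, J') = b (L (J, J'))"
    using w unfolding partition_weight_def by (elim exE) (rule that)
  have L: "set_of (L (J, J')) \<subseteq> set_of J"
      "{x \<in> set_of J. \<exists>a\<in>set_of \<omega>. f a x \<in> set_of J'} \<subseteq> set_of (L (J, J'))"
      "\<forall>y\<in>set_of (DF (L (J, J'))). w (J, J') \<le> ln \<bar>y\<bar>"
    using bspec[OF * e] by auto
  have "x \<in> set_of (L (J, J'))" using L(2) x by blast
  then have "Df a x \<in> set_of (DF (L (J, J')))"
    using DF[of "L (J, J')"] L(1) x by blast
  then show ?thesis using L(3) by blast
qed

lemma expansion_lower_bound:
  fixes S :: "real set" and f Df :: "real \<Rightarrow> real \<Rightarrow> real"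
  assumes a: "a \<in> set_of \<omega>" and S: "compact S"
    and cont: "continuous_on S (Df a)" and nz: "\<And>x. x \<in> S \<Longrightarrow> Df a x \<noteq> 0"
    and F: "\<And>J. set_of J \<subseteq> S \<Longrightarrow> {f a x | a x. a \<in> set_of \<omega> \<and> x \<in> set_of J} \<subseteq> set_of (F J)"
    and DF: "\<And>J. set_of J \<subseteq> S \<Longrightarrow> {Df a x | a x. a \<in> set_of \<omega> \<and> x \<in> set_of J} \<subseteq> set_of (DF J)"
    and P: "subordinate_cover S P" and w: "partition_weight \<omega> f F DF P w"
    and r: "min_cycle_mean (partition_graph F P) w (ereal r) \<gamma>"
  shows "\<exists>C>0. \<forall>n\<ge>1. \<forall>x. (\<forall>i<n. (f a ^^ i) x \<in> S) \<longrightarrow>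
    C * exp (r * real n) \<le> \<bar>iter_deriv (f a) (Df a) n x\<bar>"
proof -
  interpret fin_pair_digraph "partition_graph F P"
    using P by (intro fin_pair_digraph_partition_graph) (simp add: subordinate_cover_def)
  let ?c = "\<lambda>e. w e - r"
  obtain r' where "ereal r = ereal r'"
      "\<And>u p. awalk u p u \<Longrightarrow> r' * real (length p) \<le> awalk_cost w p"
    by (rule min_cycle_mean_le[OF r]) auto
  then have "0 \<le> awalk_cost ?c p" if "awalk u p u" for u p
    using that by (simp add: awalk_cost_shift)
  then obtain B where B: "\<And>u p v. awalk u p v \<Longrightarrow> B \<le> awalk_cost ?c p"
    using awalk_cost_bdd_below[of ?c] by metis
  \<comment> \<open>A lower bound for the last factor of the product, attained by compactness; for
    empty \<open>S\<close> any positive number will do.\<close>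
  obtain d where d: "d > 0" "\<And>x. x \<in> S \<Longrightarrow> d \<le> \<bar>Df a x\<bar>"
  proof (cases "S = {}")
    case True
    then show ?thesis using that[of 1] by simp
  next
    case False
    then obtain y where "y \<in> S" "\<And>x. x \<in> S \<Longrightarrow> \<bar>Df a y\<bar> \<le> \<bar>Df a x\<bar>"
      using continuous_attains_inf[OF S, of "\<lambda>x. \<bar>Df a x\<bar>"] cont
      by (auto intro: continuous_intros)
    then show ?thesis using that[of "\<bar>Df a y\<bar>"] nz by auto
  qed
  \<comment> \<open>In the constant, \<open>B\<close> bounds the shifted cost of the walk,
    \<open>d\<close> the last factor, and exp(-r) compensates for the walk having n - 1 arcs instead
    of n.\<close>
  have "d * exp (B - r) * exp (r * real n) \<le> \<bar>iter_deriv (f a) (Df a) n x\<bar>"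
    if n: "n \<ge> 1" and orbit: "\<And>i. i < n \<Longrightarrow> (f a ^^ i) x \<in> S" for n x
  proof -
    \<comment> \<open>The n orbit points give n vertices but only m = n - 1 arcs, since the image of
      the last point need not lie in \<open>S\<close>.\<close>
    obtain m where m: "n = Suc m" using n by (cases n) auto
    have "\<exists>J\<in>P. (f a ^^ i) x \<in> set_of J" if "i < n" for i
      using P orbit[OF that] by (auto simp: subordinate_cover_def)
    then obtain J where J: "\<And>i. i < n \<Longrightarrow> J i \<in> P" "\<And>i. i < n \<Longrightarrow> (f a ^^ i) x \<in> set_of (J i)"
      by metis
    have J_S: "set_of (J i) \<subseteq> S" if "i < n" for i
      using P J(1)[OF that] by (auto simp: subordinate_cover_def)
    have arc: "(J i, J (Suc i)) \<in> arcs (partition_graph F P)" if "i < m" for i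
    proof -
      have "(f a ^^ Suc i) x \<in> set_of (F (J i))"
        using F[OF J_S, of i] J(2)[of i] a that m by force
      then show ?thesis using J[of i] J[of "Suc i"] that m by auto
    qed
    let ?p = "map (\<lambda>i. (J i, J (Suc i))) [0..<m]"
    have "awalk (J 0) ?p (J m)"
      using J(1) m arc by (intro awalk_sequence) auto
    from B[OF this] have "B + r * real m \<le> awalk_cost w ?p"
      by (simp add: awalk_cost_shift)
    also have "\<dots> = (\<Sum>i<m. w (J i, J (Suc i)))"
      by (simp add: awalk_cost_def sum_list_sum_nth atLeast0LessThan)
    also have "\<dots> \<le> (\<Sum>i<m. ln \<bar>Df a ((f a ^^ i) x)\<bar>)"
    proof (rule sum_mono)
      fix i assume "i \<in> {..<m}"
      then show "w (J i, J (Suc i)) \<le> ln \<bar>Df a ((f a ^^ i) x)\<bar>"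
        using partition_weight_le[where S = S, OF w DF arc a J_S] J(2)[of i] J(2)[of "Suc i"] m by simp
    qed
    also have "\<dots> = ln \<bar>iter_deriv (f a) (Df a) m x\<bar>"
      unfolding iter_deriv_def abs_prod using nz orbit m by (subst ln_prod) auto
    finally have "exp (B + r * real m) \<le> exp (ln \<bar>iter_deriv (f a) (Df a) m x\<bar>)" by simp
    also have "iter_deriv (f a) (Df a) m x \<noteq> 0"
      using nz orbit m by (simp add: iter_deriv_def)
    then have "exp (ln \<bar>iter_deriv (f a) (Df a) m x\<bar>) = \<bar>iter_deriv (f a) (Df a) m x\<bar>"
      by simp
    finally have "exp (B + r * real m) * d \<le>
        \<bar>iter_deriv (f a) (Df a) m x\<bar> * \<bar>Df a ((f a ^^ m) x)\<bar>"
      using d orbit[of m] m by (intro mult_mono) auto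
    moreover have "exp (B - r) * exp (r * real n) = exp (B + r * real m)"
      unfolding exp_add[symmetric] by (simp add: m algebra_simps)
    then have "d * exp (B - r) * exp (r * real n) = exp (B + r * real m) * d"
      by (simp add: mult.assoc)
    ultimately show ?thesis by (simp only: m iter_deriv_Suc abs_mult)
  qed
  then show ?thesis
    using d(1) by (intro exI[of _ "d * exp (B - r)"]) auto
qed

section \<open>Upper bound: interval Newton test and periodic points\<close>

text \<open>Without a zero, g has constant sign. The mean value theorem on both sides of x0 rewrites
  two Newton images as Newton images of the end points. As these lie strictly inside, the two slopes
  have opposite signs, so the interval G' contains 0.\<close>

lemma interval_newton_zero:
  fixes g g' :: "real \<Rightarrow> real" and x1 x2 :: real and G' :: "real set"
  assumes x0: "x1 < x0" "x0 < x2"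
    and der: "\<And>x. x \<in> {x1..x2} \<Longrightarrow> (g has_real_derivative g' x) (at x within {x1..x2})"
    and G': "\<And>x. x \<in> {x1..x2} \<Longrightarrow> g' x \<in> G'" "is_interval G'" "0 \<notin> G'"
    and N: "\<And>z. z \<in> G' \<Longrightarrow> x0 - g x0 / z \<in> {x1<..<x2}"
  shows "\<exists>x\<in>{x1..x2}. g x = 0"
proof (rule ccontr)
  assume "\<not> ?thesis"
  then have nz: "g x \<noteq> 0" if "x \<in> {x1..x2}" for x using that by auto
  have cont: "continuous_on {x1..x2} g"
    using der by (meson DERIV_continuous_on)
  have sgn: "g x * g y > 0" if "x \<in> {x1..x2}" "y \<in> {x1..x2}" for x y
  proof (rule ccontr)
    assume *: "\<not> ?thesis"
    have iv: "is_interval (g ` {x1..x2})"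
      using connected_continuous_image[OF cont] by (simp add: is_interval_connected_1)
    have "g x \<le> 0 \<and> 0 \<le> g y \<or> g y \<le> 0 \<and> 0 \<le> g x"
      using * by (auto simp: not_less mult_le_0_iff)
    then have "0 \<in> g ` {x1..x2}" using mem_is_interval_1_I[OF iv] that by blast
    then show False using nz by auto
  qed
  have mvt: "\<exists>\<xi>\<in>{x1..x2}. g v - g u = g' \<xi> * (v - u)"
    if "x1 \<le> u" "u \<le> v" "v \<le> x2" for u v
  proof -
    have "\<exists>\<xi>\<in>{u..v}. g v - g u = (\<lambda>h. g' \<xi> * h) (v - u)"
    proof (rule mvt_very_simple)
      fix x assume "u \<le> x" "x \<le> v"
      then have "(g has_real_derivative g' x) (at x within {u..v})"
        using that by (intro DERIV_subset[OF der]) auto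
      then show "(g has_derivative (\<lambda>h. g' x * h)) (at x within {u..v})"
        by (simp add: has_field_derivative_def)
    qed (use that in auto)
    then show ?thesis using that by fastforce
  qed
  obtain \<xi>1 where \<xi>1: "\<xi>1 \<in> {x1..x2}" "g x0 - g x1 = g' \<xi>1 * (x0 - x1)"
    using mvt[of x1 x0] x0 by auto
  obtain \<xi>2 where \<xi>2: "\<xi>2 \<in> {x1..x2}" "g x2 - g x0 = g' \<xi>2 * (x2 - x0)"
    using mvt[of x0 x2] x0 by auto
  have in_G': "g' \<xi>1 \<in> G'" "g' \<xi>2 \<in> G'" using G'(1) \<xi>1(1) \<xi>2(1) by auto
  then have nz': "g' \<xi>1 \<noteq> 0" "g' \<xi>2 \<noteq> 0" using G'(3) by metis+
  \<comment> \<open>With the mean value slope, the Newton step from \<open>x0\<close> lands at the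
    same point as the step from \<open>x1\<close>.\<close>
  have "x0 - g x0 / g' \<xi>1 = x1 - g x1 / g' \<xi>1"
    using \<xi>1(2) nz' by (simp add: field_simps)
  then have left: "g x1 / g' \<xi>1 < 0" using N[OF in_G'(1)] by simp
  have "x0 - g x0 / g' \<xi>2 = x2 - g x2 / g' \<xi>2"
    using \<xi>2(2) nz' by (simp add: field_simps)
  then have right: "g x2 / g' \<xi>2 > 0" using N[OF in_G'(2)] by simp
  have "g' \<xi>1 * g' \<xi>2 < 0"
    using left right sgn[of x1 x2] x0
    by (auto simp: divide_less_0_iff zero_less_divide_iff zero_less_mult_iff mult_less_0_iff)
  then have "g' \<xi>1 \<le> 0 \<and> 0 \<le> g' \<xi>2 \<or> g' \<xi>2 \<le> 0 \<and> 0 \<le> g' \<xi>1"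
    by (auto simp: mult_less_0_iff)
  then have "0 \<in> G'" using mem_is_interval_1_I[OF G'(2)] in_G' by blast
  then show False using G'(3) by contradiction
qed

text \<open>The enclosures \<open>Fi\<close> keep the orbit of \<open>X\<close> outside \<Delta> up
  to time n. Hence \<open>iter_deriv\<close> is the derivative of the iterate on \<open>X\<close>,
  and the Newton test applies to x minus its n-th iterate.\<close>

lemma periodic_orbit_periodic_point:
  assumes per: "periodic_orbit f Df \<Delta> X n (Some lmax)" and X: "set_of X \<subseteq> S - \<Delta>" and "n > 0"
    and maps: "f ` (S - \<Delta>) \<subseteq> S"
    and der: "\<And>y. y \<in> S - \<Delta> \<Longrightarrow> (f has_real_derivative Df y) (at y within S - \<Delta>)"
  shows "\<exists>x. (f ^^ n) x = x \<and> (\<forall>i. (f ^^ i) x \<in> S - \<Delta>) \<and>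
    ln \<bar>iter_deriv f Df n x\<bar> \<le> real n * lmax"
  using per
proof cases
  case (success x0 Fx0 Gx0 F' G' N Fi)
  have orbit: "(f ^^ i) x \<in> S - \<Delta>" if "x \<in> set_of X" "i \<le> n" for x i
    using that(2)
  proof (induction i)
    case 0
    then show ?case using X that(1) by auto
  next
    case (Suc i)
    then have "(f ^^ Suc i) x \<in> S" using maps by auto
    moreover have "(f ^^ Suc i) x \<in> set_of (Fi (Suc i))"
      using success(10) Suc.prems that(1) by (metis One_nat_def Suc_le_mono atLeastAtMost_iff image_subset_iff le0)
    ultimately show ?case using success(11) Suc.prems by fastforce
  qed
  have sub: "set_of X \<subseteq> iter_dom S \<Delta> f n"
    using orbit orbit[of _ 0] by (fastforce simp: iter_dom_def)
  have X_eq: "set_of X = {lower X..upper X}" by (simp add: set_of_eq)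
  have N: "x0 - (x0 - (f ^^ n) x0) / z \<in> {lower X<..<upper X}" if "z \<in> set_of G'" for z
  proof -
    have "x0 - (x0 - (f ^^ n) x0) / z \<in> set_of N" using success(3,7) that by blast
    then show ?thesis
      using success(8) unfolding X_eq interior_atLeastAtMost_real by blast
  qed
  \<comment> \<open>Since \<open>G'\<close> is nonempty, some Newton image lies strictly between the
    end points; so \<open>X\<close> is not a single point and its midpoint is interior.\<close>
  have "lower G' \<in> set_of G'" by (simp add: set_of_eq)
  from N[OF this] have "lower X < upper X" by auto
  then have x0: "lower X < x0" "x0 < upper X" by (auto simp: success(1) field_simps)
  have "\<exists>x\<in>{lower X..upper X}. x - (f ^^ n) x = 0"
  proof (rule interval_newton_zero[where G' = "set_of G'"])
    fix x assume x: "x \<in> {lower X..upper X}"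
    have "((f ^^ n) has_real_derivative iter_deriv f Df n x) (at x within iter_dom S \<Delta> f n)"
      using x sub by (intro has_real_derivative_iter_deriv maps der) (auto simp: X_eq)
    then have "((f ^^ n) has_real_derivative iter_deriv f Df n x) (at x within {lower X..upper X})"
      by (rule DERIV_subset) (use sub X_eq in simp)
    then show "((\<lambda>x. x - (f ^^ n) x) has_real_derivative 1 - iter_deriv f Df n x)
        (at x within {lower X..upper X})"
      by (rule DERIV_diff[OF DERIV_ident])
    show "1 - iter_deriv f Df n x \<in> set_of G'" using success(5) x by (simp add: X_eq)
  qed (use x0 N success(6) in \<open>auto simp: set_of_eq is_interval_cc\<close>)
  then obtain x where x: "x \<in> set_of X" "(f ^^ n) x = x" by (auto simp: X_eq)
  \<comment> \<open>Periodicity reduces any time to one below n.\<close>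
  have "(f ^^ i) x \<in> S - \<Delta>" for i
    using orbit[OF x(1), of "i mod n"] funpow_mod_eq[OF x(2), of i] assms(3) by simp
  moreover have "ln \<bar>iter_deriv f Df n x\<bar> \<le> real n * lmax"
    using success(12) x(1) assms(3) by (auto simp: field_simps)
  ultimately show ?thesis using x(2) by blast
qed

text \<open>Taking logarithms of the assumed growth at the times k n gives ln C + (r - lmax) n k
  \<le> 0 for all k \<ge> 1, which fails for large k if r > lmax.\<close>

lemma periodic_expansion_upper_bound:
  assumes "(f ^^ n) x = x" and n: "n > 0"
    and nz: "\<And>i. Df ((f ^^ i) x) \<noteq> 0"
    and lmax: "ln \<bar>iter_deriv f Df n x\<bar> \<le> real n * lmax"
    and C: "C > 0" "\<And>m. m \<ge> 1 \<Longrightarrow> C * exp (r * real m) \<le> \<bar>iter_deriv f Df m x\<bar>"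
  shows "r \<le> lmax"
proof (rule ccontr)
  assume "\<not> r \<le> lmax"
  then have pos: "0 < (r - lmax) * real n" using n by simp
  let ?A = "\<bar>iter_deriv f Df n x\<bar>"
  have A: "0 < ?A" using nz by (simp add: iter_deriv_def)
  have bound: "ln C + (r - lmax) * real n * real k \<le> 0" if k: "k \<ge> 1" for k
  proof -
    have "C * exp (r * real (k * n)) \<le> ?A ^ k"
      using C(2)[of "k * n"] k n by (simp add: iter_deriv_periodic[OF assms(1)] power_abs)
    then have "ln (C * exp (r * real (k * n))) \<le> ln (?A ^ k)"
      using C(1) A by (subst ln_le_cancel_iff) auto
    then have "ln C + r * real (k * n) \<le> real k * ln ?A"
      using C(1) A by (simp add: ln_mult ln_realpow)
    also have "\<dots> \<le> real k * (real n * lmax)" using lmax by (intro mult_left_mono) auto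
    finally show ?thesis by (simp add: algebra_simps)
  qed
  obtain k where "real k > (1 - ln C) / ((r - lmax) * real n)"
    using reals_Archimedean2 by blast
  then have "1 - ln C < (r - lmax) * real n * real k"
    using pos by (simp add: field_simps)
  \<comment> \<open>The Archimedean \<open>k\<close> may be 0, whereas \<open>bound\<close> starts
    at 1.\<close>
  then have "1 - ln C < (r - lmax) * real n * real (Suc k)"
    using pos by (simp add: algebra_simps)
  with bound[of "Suc k"] show False by simp
qed

theorem proposition3:
  fixes I \<omega> :: "real interval" and \<Delta> :: "real set" and D :: "real set set"
    and f Df :: "real \<Rightarrow> real \<Rightarrow> real"
    and F DF :: "real interval \<Rightarrow> real interval" and Finv :: "real interval \<Rightarrow> real set"
    and K n\<^sub>0 :: nat and \<xi> \<eta> :: real and R :: "real set"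
  assumes \<Delta>: "finite D" "\<forall>U\<in>D. open U \<and> is_interval U"
      "pairwise (\<lambda>U V. closure U \<inter> closure V = {}) D" "\<Delta> = \<Union>D" "\<Delta> \<subseteq> set_of I"
    and maps_to: "\<forall>a\<in>set_of \<omega>. f a ` (set_of I - \<Delta>) \<subseteq> set_of I"
    and C1: "\<forall>a\<in>set_of \<omega>. \<forall>x\<in>set_of I - \<Delta>.
        (f a has_real_derivative Df a x) (at x within set_of I - \<Delta>)"
      "\<forall>a\<in>set_of \<omega>. continuous_on (set_of I - \<Delta>) (Df a)"
    and nonvanishing: "\<forall>a\<in>set_of \<omega>. \<forall>x\<in>set_of I - \<Delta>. Df a x \<noteq> 0"
    and F: "\<forall>J. set_of J \<subseteq> set_of I - \<Delta> \<longrightarrow>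
        {f a x | a x. a \<in> set_of \<omega> \<and> x \<in> set_of J} \<subseteq> set_of (F J)"
    and DF: "\<forall>J. set_of J \<subseteq> set_of I - \<Delta> \<longrightarrow>
        {Df a x | a x. a \<in> set_of \<omega> \<and> x \<in> set_of J} \<subseteq> set_of (DF J)"
    and Finv: "\<forall>J. set_of J \<subseteq> set_of I - \<Delta> \<longrightarrow>
        is_interval (Finv J) \<and> compact (Finv J) \<and>
        {x \<in> set_of I - \<Delta>. \<exists>a\<in>set_of \<omega>. f a x \<in> set_of J} \<subseteq> Finv J"
    and params: "\<xi> > 0" "n\<^sub>0 > 0" "\<eta> \<ge> 1"
  shows "(\<forall>l. expansion_algorithm.expansion_exponent_returns I \<Delta> \<omega> f Df F DF K \<xi> n\<^sub>0 \<eta> R l \<longrightarrow>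
      l = \<infinity> \<or>
      (\<exists>r::real. l = ereal r \<and>
        (\<forall>a\<in>set_of \<omega>. \<exists>C>0. \<forall>n\<ge>1. \<forall>x\<in>set_of I. (\<forall>i<n. (f a ^^ i) x \<notin> \<Delta>) \<longrightarrow>
          \<bar>iter_deriv (f a) (Df a) n x\<bar> \<ge> C * exp (r * real n)))) \<and>
    (\<forall>a lmax. expansion_algorithm.expansion_exponent_obtains I \<Delta> \<omega> f Df F DF K \<xi> n\<^sub>0 \<eta> R a lmax \<longrightarrow>
      (\<forall>r C::real. C > 0 \<longrightarrow>
        (\<forall>n\<ge>1. \<forall>x\<in>set_of I. (\<forall>i<n. (f a ^^ i) x \<notin> \<Delta>) \<longrightarrow>
          \<bar>iter_deriv (f a) (Df a) n x\<bar> \<ge> C * exp (r * real n)) \<longrightarrow>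
        r \<le> lmax))"
proof (intro conjI allI impI)
  let ?S = "set_of I - \<Delta>"
  \<comment> \<open>Openness of \<Delta> makes \<open>?S\<close> compact, which keeps the derivative
    away from 0 in \<open>expansion_lower_bound\<close>.\<close>
  have "open \<Delta>" using \<Delta>(2,4) by auto
  then have compact: "compact ?S" by (intro compact_diff) (auto simp: set_of_eq)
  fix l
  assume "expansion_algorithm.expansion_exponent_returns I \<Delta> \<omega> f Df F DF K \<xi> n\<^sub>0 \<eta> R l"
  then obtain P w \<gamma> where P: "subordinate_cover ?S P"
      "partition_weight \<omega> f F DF P w" "min_cycle_mean (partition_graph F P) w l \<gamma>"
    by (rule expansion_algorithm.expansion_exponent_returnsE)
  interpret fin_pair_digraph "partition_graph F P"
    using P(1) by (intro fin_pair_digraph_partition_graph) (simp add: subordinate_cover_def)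
  show "l = \<infinity> \<or> (\<exists>r::real. l = ereal r \<and>
        (\<forall>a\<in>set_of \<omega>. \<exists>C>0. \<forall>n\<ge>1. \<forall>x\<in>set_of I. (\<forall>i<n. (f a ^^ i) x \<notin> \<Delta>) \<longrightarrow>
          \<bar>iter_deriv (f a) (Df a) n x\<bar> \<ge> C * exp (r * real n)))"
  proof (cases "l = \<infinity>")
    case False
    then obtain r where r: "l = ereal r" by (rule min_cycle_mean_le[OF P(3)])
    have "\<exists>C>0. \<forall>n\<ge>1. \<forall>x\<in>set_of I. (\<forall>i<n. (f a ^^ i) x \<notin> \<Delta>) \<longrightarrow>
          \<bar>iter_deriv (f a) (Df a) n x\<bar> \<ge> C * exp (r * real n)" if a: "a \<in> set_of \<omega>" for a
    proof -
      have "\<exists>C>0. \<forall>n\<ge>1. \<forall>x. (\<forall>i<n. (f a ^^ i) x \<in> ?S) \<longrightarrow>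
          C * exp (r * real n) \<le> \<bar>iter_deriv (f a) (Df a) n x\<bar>"
        by (rule expansion_lower_bound[OF a compact _ _ _ _ P(1,2) P(3)[unfolded r]])
          (use a C1(2) nonvanishing F DF in auto)
      then obtain C where C: "C > 0" "\<And>n x. n \<ge> 1 \<Longrightarrow> (\<forall>i<n. (f a ^^ i) x \<in> ?S) \<Longrightarrow>
          C * exp (r * real n) \<le> \<bar>iter_deriv (f a) (Df a) n x\<bar>"
        by blast
      have "C * exp (r * real n) \<le> \<bar>iter_deriv (f a) (Df a) n x\<bar>"
        if n: "n \<ge> 1" and x: "x \<in> set_of I" "\<forall>i<n. (f a ^^ i) x \<notin> \<Delta>" for n x
      proof -
        \<comment> \<open>The orbit is only assumed to avoid \<Delta>; that it stays in I, hence in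
          \<open>?S\<close>, follows from \<open>maps_to\<close>.\<close>
        have "x \<in> iter_dom (set_of I) \<Delta> (f a) n" using x by (simp add: iter_dom_def)
        then have "(f a ^^ i) x \<in> set_of I" if "i < n" for i
          using iter_dom_orbit maps_to a that by (metis less_imp_le_nat)
        then show ?thesis using C(2) n x(2) by blast
      qed
      then show ?thesis using C(1) by blast
    qed
    then show ?thesis using r by blast
  qed simp
next
  fix a lmax r C :: real
  assume "expansion_algorithm.expansion_exponent_obtains I \<Delta> \<omega> f Df F DF K \<xi> n\<^sub>0 \<eta> R a lmax"
  then have "expansion_algorithm.certified_orbit_bound I \<Delta> \<omega> f Df a lmax"
    by (rule expansion_algorithm.expansion_exponent_obtains_certified)
  then obtain X n where a: "a \<in> set_of \<omega>" and X: "set_of X \<subseteq> set_of I - \<Delta>" "n > 0"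
      "periodic_orbit (f a) (Df a) \<Delta> X n (Some lmax)"
    unfolding expansion_algorithm.certified_orbit_bound_def by blast
  have maps: "f a ` (set_of I - \<Delta>) \<subseteq> set_of I"
    and der: "\<And>y. y \<in> set_of I - \<Delta> \<Longrightarrow>
      (f a has_real_derivative Df a y) (at y within set_of I - \<Delta>)"
    using maps_to C1(1) a by auto
  obtain x where x: "(f a ^^ n) x = x" "\<And>i. (f a ^^ i) x \<in> set_of I - \<Delta>"
      "ln \<bar>iter_deriv (f a) (Df a) n x\<bar> \<le> real n * lmax"
    using periodic_orbit_periodic_point[OF X(3,1,2) maps der] by blast
  assume "C > 0" and C: "\<forall>n\<ge>1. \<forall>x\<in>set_of I. (\<forall>i<n. (f a ^^ i) x \<notin> \<Delta>) \<longrightarrow>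
      \<bar>iter_deriv (f a) (Df a) n x\<bar> \<ge> C * exp (r * real n)"
  have "x \<in> set_of I" using x(2)[of 0] by simp
  with C x(2) have "C * exp (r * real m) \<le> \<bar>iter_deriv (f a) (Df a) m x\<bar>" if "m \<ge> 1" for m
    using that by blast
  with \<open>C > 0\<close> show "r \<le> lmax"
    using nonvanishing a x by (intro periodic_expansion_upper_bound[OF x(1) X(2) _ x(3)]) auto
qed

end
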